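(* Let $f\in\mathbb{Z}[x]$ be squarefree such that $y^2=f(x)$ is a hyperelliptic curve of genus $g$, let $p\ge g$ be a prime of good reduction for $y^2=f(x)$, and let $a_1,\ldots,a_g$ be integers that are distinct modulo $p$. For an integer $a$ let $(w_{11}(a),\ldots,w_{1g}(a))$ be the first row of the Hasse--Witt matrix $W_p(a)$ of the translated curve $y^2=f(x+a)$ at $p$. Then the system of $g^2$ linear equations $$w_{1j}(a_i)=\sum_{k=1}^g\sum_{\ell=1}^j\binom{j-1}{\ell-1}(-1)^{j-\ell}a_i^{\,k-1+j-\ell}\,w_{k\ell}\qquad(1\le i,j\le g)$$ in the $g^2$ unknowns $w_{k\ell}$ $(1\le k,\ell\le g)$ over $\mathbb{F}_p$ has a unique solution, namely the matrix of entries of the Hasse--Witt matrix $W_p=[w_{k\ell}]$ of $y^2=f(x)$ at $p$. In particular, $W_p$ is determined by the first rows of $W_p(a_1),\ldots,W_p(a_g)$.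
   Context: A prime $p$ is a prime of good reduction for $y^2=f(x)$ if the reduced equation $y^2=f(x)\bmod p$ defines a hyperelliptic curve of genus $g$ over $\mathbb{F}_p$ (that is, $p$ is odd and $f\bmod p$ is squarefree of degree $2g+1$ or $2g+2$). Hasse--Witt matrix: for a polynomial $F\in\mathbb{Z}[x]$ such that $y^2=F(x)$ has genus $g$ and good reduction at $p$, the Hasse--Witt matrix of $y^2=F(x)$ at $p$ is the $g\times g$ matrix over $\mathbb{Z}/p\mathbb{Z}=\mathbb{F}_p$ whose $(i,j)$ entry is the coefficient of $x^{pi-j}$ in $F(x)^{(p-1)/2}$, reduced modulo $p$. $W_p$ is this matrix for $F(x)=f(x)$, and $W_p(a)$ is this matrix for $F(x)=f(x+a)$. The convention $0^0=1$ is used. *)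

theory Defs
  imports
    "HOL-Number_Theory.Cong"
    "HOL-Computational_Algebra.Squarefree"
    "Berlekamp_Zassenhaus.Finite_Field"
    "Jordan_Normal_Form.Matrix"
begin

text \<open>
  The prime is \<open>p = CARD('p)\<close> for a type variable \<open>'p\<close> of class \<^class>\<open>prime_card\<close>, and
  \<open>\<int>/p\<int>\<close> is the field \<open>'p mod_ring\<close>; \<^const>\<open>of_int\<close> into that type is reduction modulo \<open>p\<close>.
  Matrices are 0-based, so the entry with mathematical index \<open>(i, j)\<close> is \<open>A $$ (i - 1, j - 1)\<close>.
\<close>

text \<open>
  The condition on \<open>F\<close> under which \<open>y\<^sup>2 = F(x)\<close> is a hyperelliptic curve of genus \<open>g\<close> over
  a field of characteristic other than 2. The characteristic is constrained where the
  predicate is used.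
\<close>
definition hyperelliptic_genus :: "'k::field poly \<Rightarrow> nat \<Rightarrow> bool" where
  "hyperelliptic_genus F g \<longleftrightarrow>
     squarefree F \<and> (degree F = 2 * g + 1 \<or> degree F = 2 * g + 2)"

definition good_reduction :: "'p::prime_card itself \<Rightarrow> int poly \<Rightarrow> nat \<Rightarrow> bool" where
  "good_reduction _ F g \<longleftrightarrow>
     odd CARD('p) \<and> hyperelliptic_genus (map_poly of_int F :: 'p mod_ring poly) g"

text \<open>
  The indices \<open>i, j\<close> start at 1. The guard makes the coefficient at a negative exponent zero
  instead of truncating the exponent; it always holds for \<open>1 \<le> i\<close> and \<open>j \<le> p\<close>.
\<close>
definition hasse_witt_entry :: "int poly \<Rightarrow> nat \<Rightarrow> nat \<Rightarrow> 'p::prime_card mod_ring" where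
  "hasse_witt_entry F i j =
     (if j \<le> CARD('p) * i
      then of_int (coeff (F ^ ((CARD('p) - 1) div 2)) (CARD('p) * i - j))
      else 0)"

definition hasse_witt :: "nat \<Rightarrow> int poly \<Rightarrow> 'p::prime_card mod_ring mat" where
  "hasse_witt g F = mat g g (\<lambda>(i, j). hasse_witt_entry F (i + 1) (j + 1))"

text \<open>The polynomial \<open>f(x + a)\<close>.\<close>
definition translate :: "int poly \<Rightarrow> int \<Rightarrow> int poly" where
  "translate f a = pcompose f [:a, 1:]"

text \<open>
  \<open>X\<close> solves the system with left-hand sides \<open>r i j\<close>; all indices run from 1 to \<open>g\<close>, and the
  natural-number subtractions below never truncate.
\<close>
definition solves_row_system ::
  "nat \<Rightarrow> (nat \<Rightarrow> int) \<Rightarrow> (nat \<Rightarrow> nat \<Rightarrow> 'k::field) \<Rightarrow> 'k mat \<Rightarrow> bool" where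
  "solves_row_system g a r X \<longleftrightarrow>
     X \<in> carrier_mat g g \<and>
     (\<forall>i\<in>{1..g}. \<forall>j\<in>{1..g}.
        r i j = (\<Sum>k=1..g. \<Sum>l=1..j.
                   of_nat ((j - 1) choose (l - 1)) * (- 1) ^ (j - l)
                   * of_int (a i) ^ (k - 1 + (j - l)) * X $$ (k - 1, l - 1)))"

end

theory Submission
  imports Defs
begin

text \<open>
  Let \<open>P\<close> be the reduction of \<open>f ^ ((p - 1) div 2)\<close> modulo
  \<open>p\<close>. The first row of \<open>W\<^sub>p(a)\<close> consists of coefficients of
  \<open>P(x + a)\<close> at exponents \<open>p - j\<close> below \<open>p\<close>, and each of
  them is a combination of all coefficients of \<open>P\<close>. Cut the exponents of
  \<open>P\<close> into blocks of length \<open>p\<close> and write an exponent of the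
  \<open>k\<close>-th block as \<open>p k - l = p (k - 1) + (p - l)\<close> with \<open>1 \<le>
  l \<le> p\<close>. Its Taylor coefficient is governed by the binomial coefficient of \<open>p
  (k - 1) + (p - l)\<close> over \<open>p - j\<close>. By Lucas, the multiple of
  \<open>p\<close> may be dropped, and reflecting the top \<open>p - l\<close>, congruent to
  \<open>- l\<close>, turns what is left into \<open>(j - 1) choose (l - 1)\<close> with a
  sign, which is zero unless \<open>l \<le> j\<close>. By Fermat, \<open>a ^ (p (k -
  1))\<close> is \<open>a ^ (k - 1)\<close>. So only coefficients with \<open>l \<le> j \<le>
  g\<close> survive; those in blocks \<open>k \<le> g\<close> are entries of
  \<open>W\<^sub>p\<close>, and those in block \<open>g + 1\<close> vanish because \<open>deg P
  \<le> (g + 1) (p - 1)\<close>. This is \<open>coeff_shift_first_block\<close>; it says that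
  \<open>W\<^sub>p\<close> solves the system.

  The system is block triangular in the columns of the unknown matrix: the equations for
  \<open>j\<close> involve columns \<open>l \<le> j\<close> only, and column \<open>j\<close>
  enters through the Vandermonde matrix of the \<open>a\<^sub>i\<close>, which are distinct in
  \<open>\<int>/p\<int>\<close>. Hence solutions are unique
  (\<open>solves_row_system_unique\<close>). Since the Hasse--Witt matrix of any other curve
  with the same first rows solves the same system, it equals \<open>W\<^sub>p\<close>.
\<close>

section \<open>Binomial coefficients in prime characteristic\<close>

lemma of_nat_CHAR_choose:
  assumes "prime CHAR('a::comm_ring_1)" "t < CHAR('a)"
  shows "(of_nat (CHAR('a) choose t) :: 'a) = (if t = 0 then 1 else 0)"
  using assms dvd_choose_prime[of t "CHAR('a)"] prime_gt_0_nat[of "CHAR('a)"]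
  by (auto simp: of_nat_eq_0_iff_char_dvd)

text \<open>
  The case of Lucas' theorem with a lower entry of one digit: in Vandermonde's convolution for
  a top \<open>p + m\<close>, every \<open>p choose i\<close> with \<open>0 < i < p\<close>
  vanishes.
\<close>
lemma of_nat_mult_CHAR_add_choose:
  assumes "prime CHAR('a::comm_ring_1)" "s < CHAR('a)"
  shows "(of_nat ((k * CHAR('a) + n) choose s) :: 'a) = of_nat (n choose s)"
proof (induction k)
  case 0
  show ?case by simp
next
  case (Suc k)
  have "(of_nat ((Suc k * CHAR('a) + n) choose s) :: 'a)
      = of_nat ((CHAR('a) + (k * CHAR('a) + n)) choose s)"
    by (simp add: add.assoc)
  also have "\<dots> = (\<Sum>i\<le>s. of_nat (CHAR('a) choose i) * of_nat ((k * CHAR('a) + n) choose (s - i)))"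
    by (simp flip: vandermonde)
  also have "\<dots> = (\<Sum>i\<le>s. if i = 0 then of_nat ((k * CHAR('a) + n) choose s) else 0)"
    by (rule sum.cong) (use assms in \<open>auto simp: of_nat_CHAR_choose\<close>)
  also have "\<dots> = of_nat (n choose s)"
    by (simp add: Suc.IH)
  finally show ?case .
qed

text \<open>
  Upper negation \<open>(- n) choose t = (- 1) ^ t * ((n + t - 1) choose t)\<close> for
  \<open>n = l + 1\<close>, with \<open>- n\<close> represented by \<open>p - n\<close>. A
  polynomial argument in the top would divide by \<open>fact t\<close>; Pascal's rule avoids
  the division.
\<close>
lemma of_nat_CHAR_minus_choose:
  assumes "prime CHAR('a::comm_ring_1)" "Suc l + t \<le> CHAR('a)"
  shows "(of_nat ((CHAR('a) - Suc l) choose t) :: 'a) = (- 1) ^ t * of_nat ((l + t) choose t)"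
  using assms(2)
proof (induction l arbitrary: t)
  case 0
  then show ?case
  proof (induction t)
    case (Suc t)
    have "CHAR('a) choose Suc t = ((CHAR('a) - 1) choose t) + ((CHAR('a) - 1) choose Suc t)"
      using Suc.prems by (cases "CHAR('a)") auto
    moreover have "(of_nat (CHAR('a) choose Suc t) :: 'a) = 0"
      using Suc.prems assms(1) by (subst of_nat_CHAR_choose) auto
    ultimately have "(of_nat ((CHAR('a) - 1) choose Suc t) :: 'a)
        = - of_nat ((CHAR('a) - 1) choose t)"
      by (metis add_eq_0_iff of_nat_add)
    with Suc show ?case by simp
  qed simp
next
  case (Suc l)
  note outer = Suc.IH
  from Suc.prems show ?case
  proof (induction t)
    case (Suc t)
    have "CHAR('a) - Suc l = Suc (CHAR('a) - Suc (Suc l))"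
      using Suc.prems by auto
    then have "(CHAR('a) - Suc l) choose Suc t
        = ((CHAR('a) - Suc (Suc l)) choose t) + ((CHAR('a) - Suc (Suc l)) choose Suc t)"
      by simp
    then have "(of_nat ((CHAR('a) - Suc (Suc l)) choose Suc t) :: 'a)
        = of_nat ((CHAR('a) - Suc l) choose Suc t) - of_nat ((CHAR('a) - Suc (Suc l)) choose t)"
      by simp
    then show ?case
      using Suc outer[of "Suc t"] by (simp add: algebra_simps)
  qed simp
qed

section \<open>Translating a polynomial over the prime field\<close>

lemma coeff_pcompose_shift:
  fixes P :: "'a::comm_ring_1 poly"
  assumes "degree P < N"
  shows "coeff (pcompose P [:c, 1:]) n = (\<Sum>m<N. coeff P m * of_nat (m choose n) * c ^ (m - n))"
proof -
  obtain M where N: "N = Suc M" and M: "degree P \<le> M"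
    using assms by (cases N) auto
  have "pcompose P [:c, 1:] = pcompose (\<Sum>m\<le>M. monom (coeff P m) m) [:c, 1:]"
    by (simp only: poly_as_sum_of_monoms'[OF M])
  also have "\<dots> = (\<Sum>m\<le>M. smult (coeff P m) ([:c, 1:] ^ m))"
    by (simp add: pcompose_sum pcompose_smult monom_altdef pcompose_hom.hom_power pcompose_pCons)
  moreover have "coeff ([:c, 1:] ^ m) n = of_nat (m choose n) * c ^ (m - n)" for m
  proof (cases "n \<le> m")
    case True
    then show ?thesis by (simp add: coeff_linear_poly_power)
  next
    case False
    have "degree ([:c, 1:] ^ m) \<le> m"
      using degree_power_le[of "[:c, 1:]" m] by simp
    then show ?thesis using False by (simp add: coeff_eq_0 binomial_eq_0)
  qed
  ultimately show ?thesis
    by (simp add: coeff_sum N lessThan_Suc_atMost mult.assoc)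
qed

text \<open>
  The bound on \<open>j\<close> by \<open>g\<close> is what makes the sum stop at \<open>k =
  g\<close>: the block \<open>k = g + 1\<close> would contribute coefficients at \<open>(g + 1)
  p - l\<close> with \<open>l \<le> g\<close>, just above the degree bound.
\<close>
lemma coeff_shift_first_block:
  fixes P :: "'p::prime_card mod_ring poly"
  assumes deg: "degree P \<le> (g + 1) * (CARD('p) - 1)"
    and j: "1 \<le> j" "j \<le> g" and g: "g \<le> CARD('p)"
  shows "coeff (pcompose P [:c, 1:]) (CARD('p) - j)
       = (\<Sum>k=1..g. \<Sum>l=1..j. of_nat ((j - 1) choose (l - 1)) * (- 1) ^ (j - l)
            * c ^ (k - 1 + (j - l)) * coeff P (CARD('p) * k - l))"
proof -
  define p where "p = CARD('p)"
  have char: "CHAR('p mod_ring) = p" by (simp add: p_def)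
  have prime: "prime p" unfolding p_def by (rule prime_card)
  have p0: "p > 0" using prime by (rule prime_gt_0_nat)
  have jp: "j \<le> p" using j g by (simp add: p_def)
  define T where "T m = coeff P m * of_nat (m choose (p - j)) * c ^ (m - (p - j))" for m
  define S where "S k l = of_nat ((j - 1) choose (l - 1)) * (- 1) ^ (j - l)
            * c ^ (k - 1 + (j - l)) * coeff P (p * k - l)" for k l
  have T_zero: "T (k * p + (p - l)) = 0" if "j < l" "l \<le> p" for k l
  proof -
    have "(of_nat ((k * p + (p - l)) choose (p - j)) :: 'p mod_ring) = of_nat ((p - l) choose (p - j))"
      using of_nat_mult_CHAR_add_choose[where 'a="'p mod_ring", of "p - j" k "p - l"]
        prime j p0 unfolding char by simp
    then show ?thesis using that by (simp add: T_def binomial_eq_0)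
  qed
  have T_eq: "T (k * p + (p - l)) = S (Suc k) l" if l: "1 \<le> l" "l \<le> j" for k l
  proof -
    have "(of_nat ((k * p + (p - l)) choose (p - j)) :: 'p mod_ring) = of_nat ((p - l) choose (p - j))"
      using of_nat_mult_CHAR_add_choose[where 'a="'p mod_ring", of "p - j" k "p - l"]
        prime j p0 unfolding char by simp
    also have "(p - l) choose (p - j) = (p - Suc (l - 1)) choose (j - l)"
      using l jp binomial_symmetric[of "p - j" "p - l"] by simp
    also have "(of_nat \<dots> :: 'p mod_ring) = (- 1) ^ (j - l) * of_nat ((j - 1) choose (j - l))"
      using of_nat_CHAR_minus_choose[where 'a="'p mod_ring", of "l - 1" "j - l"]
        prime l jp unfolding char by simp
    also have "(j - 1) choose (j - l) = (j - 1) choose (l - 1)"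
      using l binomial_symmetric[of "l - 1" "j - 1"] by simp
    finally have B: "(of_nat ((k * p + (p - l)) choose (p - j)) :: 'p mod_ring)
        = (- 1) ^ (j - l) * of_nat ((j - 1) choose (l - 1))" .
    have "k * p + (p - l) - (p - j) = p * k + (j - l)"
      using l jp by (simp add: mult.commute)
    moreover have "c ^ p = c"
      using finite_field_power_card_eq_same[of c] by (simp add: p_def)
    ultimately have E: "c ^ (k * p + (p - l) - (p - j)) = c ^ (k + (j - l))"
      by (simp add: power_add power_mult)
    have "k * p + (p - l) = p * Suc k - l"
      using l jp by (simp add: mult.commute)
    then show ?thesis
      unfolding T_def S_def B E by (simp add: mult_ac)
  qed
  have block: "sum T {k * p..<k * p + p} = (\<Sum>l=1..j. S (Suc k) l)" for k
  proof -
    have "sum T {k * p..<k * p + p} = (\<Sum>l=1..p. T (k * p + (p - l)))"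
      by (rule sum.reindex_bij_witness[of _ "\<lambda>l. k * p + (p - l)" "\<lambda>m. k * p + p - m"]) auto
    also have "\<dots> = (\<Sum>l=1..j. T (k * p + (p - l)))"
      by (rule sum.mono_neutral_right) (use jp T_zero in auto)
    finally show ?thesis using T_eq by simp
  qed
  have top: "S (Suc g) l = 0" if "1 \<le> l" "l \<le> j" for l
  proof -
    have "degree P < p * Suc g - l"
      using deg that j p0 g unfolding p_def[symmetric] by (cases p) (auto simp: algebra_simps)
    then show ?thesis by (simp add: S_def coeff_eq_0)
  qed
  have "degree P < Suc g * p"
    using deg p0 unfolding p_def[symmetric] by (cases p) (auto simp: algebra_simps)
  then have "coeff (pcompose P [:c, 1:]) (p - j) = (\<Sum>m<Suc g * p. T m)"
    unfolding T_def by (rule coeff_pcompose_shift)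
  also have "\<dots> = (\<Sum>k<Suc g. \<Sum>l=1..j. S (Suc k) l)"
    by (simp only: sum.nat_group[symmetric] block)
  also have "\<dots> = (\<Sum>k<g. \<Sum>l=1..j. S (Suc k) l)"
    using top by simp
  also have "\<dots> = (\<Sum>k=1..g. \<Sum>l=1..j. S k l)"
    by (rule sum.reindex_bij_witness[of _ "\<lambda>k. k - 1" Suc]) auto
  finally show ?thesis unfolding S_def p_def .
qed

section \<open>The linear system\<close>

lemma hasse_witt_index:
  assumes "i \<in> {1..g}" "j \<in> {1..g}" "g \<le> CARD('p::prime_card)"
  shows "(hasse_witt g F :: 'p mod_ring mat) $$ (i - 1, j - 1)
       = coeff (map_poly of_int (F ^ ((CARD('p) - 1) div 2))) (CARD('p) * i - j)"
proof -
  have "j \<le> CARD('p)" using assms by auto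
  also have "\<dots> \<le> CARD('p) * i" using assms by simp
  finally have le: "j \<le> CARD('p) * i" .
  have ij: "i - 1 < g" "j - 1 < g" "i - 1 + 1 = i" "j - 1 + 1 = j"
    using assms by auto
  have "(hasse_witt g F :: 'p mod_ring mat) $$ (i - 1, j - 1) = hasse_witt_entry F i j"
    unfolding hasse_witt_def using ij by (simp only: index_mat prod.case)
  then show ?thesis
    using le by (simp add: hasse_witt_entry_def)
qed

lemma solves_row_system_hasse_witt:
  fixes f :: "int poly" and a :: "nat \<Rightarrow> int"
  assumes good: "good_reduction TYPE('p::prime_card) f g" and g: "g \<le> CARD('p)"
  shows "solves_row_system g a (\<lambda>i j. hasse_witt g (translate f (a i)) $$ (0, j - 1))
           (hasse_witt g f :: 'p mod_ring mat)"
proof -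
  define n where "n = (CARD('p) - 1) div 2"
  define P where "P = (map_poly of_int (f ^ n) :: 'p mod_ring poly)"
  have n: "CARD('p) - 1 = 2 * n"
    using good by (auto simp: good_reduction_def n_def)
  have "degree P \<le> degree (map_poly of_int f :: 'p mod_ring poly) * n"
    unfolding P_def by (simp add: hom_distribs degree_power_le)
  also have "\<dots> \<le> (2 * g + 2) * n"
    using good by (auto simp: good_reduction_def hyperelliptic_genus_def)
  finally have deg: "degree P \<le> (g + 1) * (CARD('p) - 1)"
    unfolding n by (simp add: algebra_simps)
  have "hasse_witt g (translate f c) $$ (0, j - 1)
      = (\<Sum>k=1..g. \<Sum>l=1..j. of_nat ((j - 1) choose (l - 1)) * (- 1) ^ (j - l)
            * of_int c ^ (k - 1 + (j - l)) * (hasse_witt g f :: 'p mod_ring mat) $$ (k - 1, l - 1))"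
    if j: "j \<in> {1..g}" for c j
  proof -
    have "(hasse_witt g (translate f c) :: 'p mod_ring mat) $$ (0, j - 1)
        = coeff (map_poly of_int (translate f c ^ n)) (CARD('p) - j)"
      using hasse_witt_index[of 1 g j "translate f c"] j g by (simp add: n_def)
    also have "map_poly of_int (translate f c ^ n) = pcompose P [:of_int c, 1:]"
      by (simp add: P_def translate_def hom_distribs pcompose_hom.hom_power)
    also have "coeff \<dots> (CARD('p) - j)
       = (\<Sum>k=1..g. \<Sum>l=1..j. of_nat ((j - 1) choose (l - 1)) * (- 1) ^ (j - l)
            * of_int c ^ (k - 1 + (j - l)) * coeff P (CARD('p) * k - l))"
      by (rule coeff_shift_first_block[OF deg]) (use j g in auto)
    also have "\<dots> = (\<Sum>k=1..g. \<Sum>l=1..j. of_nat ((j - 1) choose (l - 1)) * (- 1) ^ (j - l)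
            * of_int c ^ (k - 1 + (j - l)) * (hasse_witt g f :: 'p mod_ring mat) $$ (k - 1, l - 1))"
    proof (intro sum.cong refl)
      fix k l assume kl: "k \<in> {1..g}" "l \<in> {1..j}"
      then have "l \<in> {1..g}" using j by auto
      then have "coeff P (CARD('p) * k - l) = (hasse_witt g f :: 'p mod_ring mat) $$ (k - 1, l - 1)"
        unfolding P_def n_def using kl g by (simp only: hasse_witt_index)
      then show "of_nat ((j - 1) choose (l - 1)) * (- 1) ^ (j - l)
            * of_int c ^ (k - 1 + (j - l)) * coeff P (CARD('p) * k - l)
          = of_nat ((j - 1) choose (l - 1)) * (- 1) ^ (j - l)
            * of_int c ^ (k - 1 + (j - l)) * (hasse_witt g f :: 'p mod_ring mat) $$ (k - 1, l - 1)"
        by (simp only:)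
    qed
    finally show ?thesis .
  qed
  then show ?thesis
    by (simp add: solves_row_system_def hasse_witt_def)
qed

text \<open>
  A kernel vector lists the coefficients of a polynomial of degree less than \<open>g\<close>
  with \<open>g\<close> distinct roots.
\<close>
lemma vandermonde_kernel_trivial:
  fixes b :: "nat \<Rightarrow> 'k::idom"
  assumes inj: "inj_on b {1..g}"
    and zero: "\<And>i. i \<in> {1..g} \<Longrightarrow> (\<Sum>k=1..g. b i ^ (k - 1) * d k) = 0"
    and k: "k \<in> {1..g}"
  shows "d k = 0"
proof -
  define Q where "Q = (\<Sum>k=1..g. monom (d k) (k - 1))"
  have "degree Q \<le> g - 1"
    unfolding Q_def by (intro degree_sum_le) (auto intro: order.trans[OF degree_monom_le])
  then have "degree Q < g" using k by auto
  moreover have "poly Q x = 0" if "x \<in> b ` {1..g}" for x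
    using that zero by (auto simp: Q_def poly_sum poly_monom mult.commute)
  ultimately have "Q = 0"
    using card_image[OF inj] poly_eqI_degree[of "b ` {1..g}" Q 0] by simp
  moreover have "coeff Q (k - 1) = (\<Sum>k'=1..g. if k' = k then d k' else 0)"
    unfolding Q_def coeff_sum by (rule sum.cong) (use k in auto)
  ultimately show ?thesis using k by simp
qed

text \<open>
  Two solutions agree column by column, from left to right: once the columns before
  \<open>j\<close> agree, the difference of the equations for \<open>j\<close> is a Vandermonde
  system for the difference of the \<open>j\<close>-th columns, because the coefficient for
  \<open>l = j\<close> is just \<open>a\<^sub>i ^ (k - 1)\<close>.
\<close>
lemma solves_row_system_unique:
  fixes X Y :: "'k::field mat"
  assumes inj: "inj_on (\<lambda>i. of_int (a i) :: 'k) {1..g}"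
    and X: "solves_row_system g a r X" and Y: "solves_row_system g a r Y"
  shows "X = Y"
proof -
  have column: "\<forall>k\<in>{1..g}. X $$ (k - 1, j - 1) = Y $$ (k - 1, j - 1)" if "j \<in> {1..g}" for j
    using that
  proof (induction j rule: less_induct)
    case (less j)
    define w :: "nat \<Rightarrow> nat \<Rightarrow> nat \<Rightarrow> 'k" where
      "w i k l = of_nat ((j - 1) choose (l - 1)) * (- 1) ^ (j - l)
                   * of_int (a i) ^ (k - 1 + (j - l))" for i k l
    have rest: "(\<Sum>l=1..j. w i k l * X $$ (k - 1, l - 1)) - (\<Sum>l=1..j. w i k l * Y $$ (k - 1, l - 1))
        = of_int (a i) ^ (k - 1) * (X $$ (k - 1, j - 1) - Y $$ (k - 1, j - 1))"
      if "k \<in> {1..g}" for i k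
    proof -
      have "(\<Sum>l=1..j. w i k l * X $$ (k - 1, l - 1)) - (\<Sum>l=1..j. w i k l * Y $$ (k - 1, l - 1))
          = (\<Sum>l=1..j. w i k l * (X $$ (k - 1, l - 1) - Y $$ (k - 1, l - 1)))"
        by (simp add: sum_subtractf right_diff_distrib)
      also have "\<dots> = (\<Sum>l=1..j. if l = j
            then of_int (a i) ^ (k - 1) * (X $$ (k - 1, j - 1) - Y $$ (k - 1, j - 1)) else 0)"
      proof (rule sum.cong[OF refl])
        fix l assume l: "l \<in> {1..j}"
        show "w i k l * (X $$ (k - 1, l - 1) - Y $$ (k - 1, l - 1)) = (if l = j
            then of_int (a i) ^ (k - 1) * (X $$ (k - 1, j - 1) - Y $$ (k - 1, j - 1)) else 0)"
        proof (cases "l = j")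
          case False
          then show ?thesis using less.IH[of l] less.prems l that by simp
        qed (simp add: w_def)
      qed
      also have "\<dots> = of_int (a i) ^ (k - 1) * (X $$ (k - 1, j - 1) - Y $$ (k - 1, j - 1))"
        using less.prems by simp
      finally show ?thesis .
    qed
    have "(\<Sum>k=1..g. of_int (a i) ^ (k - 1) * (X $$ (k - 1, j - 1) - Y $$ (k - 1, j - 1))) = 0"
      if i: "i \<in> {1..g}" for i
    proof -
      have "(\<Sum>k=1..g. \<Sum>l=1..j. w i k l * X $$ (k - 1, l - 1))
          = (\<Sum>k=1..g. \<Sum>l=1..j. w i k l * Y $$ (k - 1, l - 1))"
        using X Y i less.prems unfolding solves_row_system_def w_def by (metis (no_types, lifting))
      moreover have "(\<Sum>k=1..g. of_int (a i) ^ (k - 1) * (X $$ (k - 1, j - 1) - Y $$ (k - 1, j - 1)))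
          = (\<Sum>k=1..g. (\<Sum>l=1..j. w i k l * X $$ (k - 1, l - 1))
                      - (\<Sum>l=1..j. w i k l * Y $$ (k - 1, l - 1)))"
        by (rule sum.cong[OF refl]) (simp only: rest)
      ultimately show ?thesis
        by (simp only: sum_subtractf diff_self)
    qed
    from vandermonde_kernel_trivial[OF inj this] show ?case
      by simp
  qed
  have carrier: "X \<in> carrier_mat g g" "Y \<in> carrier_mat g g"
    using X Y by (simp_all only: solves_row_system_def)
  show ?thesis
  proof (rule eq_matI)
    fix i j assume ij: "i < dim_row Y" "j < dim_col Y"
    then have "Suc i \<in> {1..g}" "Suc j \<in> {1..g}"
      using carrier by auto
    then show "X $$ (i, j) = Y $$ (i, j)"
      using column[of "Suc j"] by fastforce
  qed (use carrier in auto)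
qed

theorem mainTheorem3:
  fixes f :: "int poly" and g :: nat and a :: "nat \<Rightarrow> int"
  assumes curve: "hyperelliptic_genus (map_poly of_int f :: rat poly) g"
    and good: "good_reduction TYPE('p::prime_card) f g"
    and p_ge: "CARD('p) \<ge> g"
    and distinct: "\<forall>i\<in>{1..g}. \<forall>j\<in>{1..g}. i \<noteq> j \<longrightarrow> \<not> [a i = a j] (mod int CARD('p))"
  shows "(\<exists>!X :: 'p mod_ring mat.
            solves_row_system g a (\<lambda>i j. hasse_witt g (translate f (a i)) $$ (0, j - 1)) X)
       \<and> solves_row_system g a (\<lambda>i j. hasse_witt g (translate f (a i)) $$ (0, j - 1))
            (hasse_witt g f :: 'p mod_ring mat)
       \<and> (\<forall>h :: int poly.
            hyperelliptic_genus (map_poly of_int h :: rat poly) g \<longrightarrow>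
            good_reduction TYPE('p) h g \<longrightarrow>
            (\<forall>i\<in>{1..g}. row (hasse_witt g (translate h (a i)) :: 'p mod_ring mat) 0
                       = row (hasse_witt g (translate f (a i))) 0) \<longrightarrow>
            (hasse_witt g h :: 'p mod_ring mat) = hasse_witt g f)"
proof -
  let ?r = "\<lambda>i j. (hasse_witt g (translate f (a i)) :: 'p mod_ring mat) $$ (0, j - 1)"
  have inj: "inj_on (\<lambda>i. of_int (a i) :: 'p mod_ring) {1..g}"
    using distinct by (auto simp: inj_on_def of_int_eq_iff_cong_CHAR)
  have sol: "solves_row_system g a ?r (hasse_witt g f)"
    by (rule solves_row_system_hasse_witt[OF good p_ge])
  have determined: "(hasse_witt g h :: 'p mod_ring mat) = hasse_witt g f"
    if h: "good_reduction TYPE('p) h g"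
      and rows: "\<forall>i\<in>{1..g}. row (hasse_witt g (translate h (a i)) :: 'p mod_ring mat) 0
                       = row (hasse_witt g (translate f (a i))) 0" for h
  proof -
    have "(hasse_witt g (translate h (a i)) :: 'p mod_ring mat) $$ (0, j - 1) = ?r i j"
      if "i \<in> {1..g}" "j \<in> {1..g}" for i j
    proof -
      have "row (hasse_witt g (translate F c) :: 'p mod_ring mat) 0 $ (j - 1)
          = hasse_witt g (translate F c) $$ (0, j - 1)" for F c
        using that by (subst index_row) (auto simp: hasse_witt_def)
      then show ?thesis using rows that by metis
    qed
    then have "solves_row_system g a ?r (hasse_witt g h)"
      using solves_row_system_hasse_witt[OF h p_ge, of a] by (simp add: solves_row_system_def)
    then show ?thesis
      using solves_row_system_unique[OF inj] sol by blast
  qed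
  show ?thesis
    using sol determined solves_row_system_unique[OF inj] by blast
qed

end
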